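(* Let $n,s$ be integers with $s\geq 2$ and $s\leq \frac{n}{2^{17}\log n}$. Let $\mathcal{F}\subset \Sigma_n$ be a family of permutations such that $\nu(\mathcal{F})<s$. Then $|\mathcal{F}|\leq (s-1)(n-1)!$. Moreover, in the case of equality, $\mathcal{F}$ is of the form $\bigcup_{i=1}^{s-1}\Sigma_n[(x,y_i)]$ or $\bigcup_{i=1}^{s-1}\Sigma_n[(x_i,y)]$, where the $y_i$'s, respectively the $x_i$'s, are distinct elements of $[n]$ (and $x$, respectively $y$, is some element of $[n]$).
   Context: $\Sigma_n$ denotes the set of all permutations $[n]\to[n]$. A permutation $\sigma$ is identified with its graph $\{(i,\sigma(i)):i\in[n]\}\subset[n]^2$; two permutations intersect iff they agree at some point. $\nu(\mathcal{F})$ is the maximum number of pairwise disjoint (non-intersecting) permutations in $\mathcal{F}$. For a pair $(x,y)\in[n]^2$, $\Sigma_n[(x,y)]$ is the set of permutations $\pi\in\Sigma_n$ with $\pi(x)=y$. *)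

theory Defs
  imports Complex_Main "HOL-Combinatorics.Permutations"
begin

definition Sym :: "nat \<Rightarrow> (nat \<Rightarrow> nat) set" where
  "Sym n = {\<sigma>. \<sigma> permutes {1..n}}"

definition intersect :: "nat \<Rightarrow> (nat \<Rightarrow> nat) \<Rightarrow> (nat \<Rightarrow> nat) \<Rightarrow> bool" where
  "intersect n \<sigma> \<tau> \<longleftrightarrow> (\<exists>i\<in>{1..n}. \<sigma> i = \<tau> i)"

definition nu :: "nat \<Rightarrow> (nat \<Rightarrow> nat) set \<Rightarrow> nat" where
  "nu n F = Max {card G | G. G \<subseteq> F \<and>
     (\<forall>\<sigma>\<in>G. \<forall>\<tau>\<in>G. \<sigma> \<noteq> \<tau> \<longrightarrow> \<not> intersect n \<sigma> \<tau>)}"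

definition Star :: "nat \<Rightarrow> nat \<Rightarrow> nat \<Rightarrow> (nat \<Rightarrow> nat) set" where
  "Star n x y = {\<pi> \<in> Sym n. \<pi> x = y}"

end

theory Submission
  imports Defs
begin

text \<open>
  Call \<open>n\<close> pairwise disjoint permutations a Latin square. Every translate of a Latin square
  contains at most \<open>s - 1\<close> members of \<open>F\<close>, and averaging over the translates gives the bound.
  If it is attained, every Latin square contains exactly \<open>s - 1\<close> members of \<open>F\<close>. Two disjoint
  permutations extend to a Latin square by Hall's theorem, and the extension survives when
  their union is split into two permutations differently. Hence the indicator \<open>f\<close> of \<open>F\<close>
  satisfies \<open>f \<sigma> + f (\<sigma> a b) = f (\<sigma> a) + f (\<sigma> b)\<close>, first for derangements \<open>a\<close>, \<open>b\<close> of
  complementary sets and then for all disjoint transpositions. It follows that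
  \<open>f \<sigma> - f (\<sigma> (i j))\<close> is a mixed second difference of a matrix indexed by positions and
  values. Because \<open>f\<close> is Boolean, any two nonzero mixed differences share a row or a column,
  which forces all of them to share the same row or the same column: \<open>f \<sigma>\<close> depends on a
  single \<open>\<sigma> x\<close> or on a single \<open>inv \<sigma> y\<close>.
\<close>

section \<open>Hall's theorem and factorization of regular relations\<close>

text \<open>Strong induction on the size of \<open>A\<close>. A tight proper subset \<open>J\<close>
  is matched inside its own neighbourhood, and the rest keeps Hall's condition outside it, as
  applying the condition to \<open>K \<union> J\<close> shows. Without a tight set every nonempty
  proper subset has a neighbour to spare, so any single pair may be fixed.\<close>

lemma hall_marriage:
  fixes N :: "'a \<Rightarrow> 'b set"
  assumes "finite A" "\<And>a. a \<in> A \<Longrightarrow> finite (N a)"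
    and "\<And>J. J \<subseteq> A \<Longrightarrow> card J \<le> card (\<Union>(N ` J))"
  shows "\<exists>f. inj_on f A \<and> (\<forall>a\<in>A. f a \<in> N a)"
  using assms
proof (induction "card A" arbitrary: A N rule: less_induct)
  case less
  note fin = less.prems(1) and finN = less.prems(2) and hall = less.prems(3)
  consider "A = {}"
    | (tight) J where "J \<subset> A" "J \<noteq> {}" "card (\<Union>(N ` J)) = card J"
    | (slack) "A \<noteq> {}" "\<And>J. J \<subset> A \<Longrightarrow> J \<noteq> {} \<Longrightarrow> card (\<Union>(N ` J)) \<noteq> card J"
    by blast
  then show ?case
  proof cases
    case 1
    then show ?thesis by simp
  next
    case tight
    have finJ: "finite J" using tight(1) fin finite_subset by blast
    have "card J < card A" using tight(1) fin by (simp add: psubset_card_mono)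
    from less.hyps[OF this finJ, of N] obtain f1
      where f1: "inj_on f1 J" "\<forall>a\<in>J. f1 a \<in> N a"
      using finN hall tight(1) by blast
    define U where "U = \<Union>(N ` J)"
    have "card (A - J) < card A"
      using tight(1,2) fin by (intro psubset_card_mono) auto
    then have "\<exists>f. inj_on f (A - J) \<and> (\<forall>a\<in>A - J. f a \<in> N a - U)"
    proof (rule less.hyps)
      fix K assume K: "K \<subseteq> A - J"
      have finK: "finite K" using K fin finite_subset by blast
      have "card K + card J = card (K \<union> J)"
        using K finK finJ by (subst card_Un_disjoint) auto
      also have "\<dots> \<le> card (\<Union>(N ` (K \<union> J)))" using K tight(1) by (intro hall) auto
      also have "\<Union>(N ` (K \<union> J)) = (\<Union>a\<in>K. N a - U) \<union> U" unfolding U_def by auto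
      also have "card \<dots> \<le> card (\<Union>a\<in>K. N a - U) + card U" by (rule card_Un_le)
      finally show "card K \<le> card (\<Union>a\<in>K. N a - U)" using tight(3) U_def by simp
    qed (use fin finN in auto)
    then obtain f2 where f2: "inj_on f2 (A - J)" "\<forall>a\<in>A - J. f2 a \<in> N a - U" by blast
    have "inj_on (\<lambda>a. if a \<in> J then f1 a else f2 a) A"
    proof (rule inj_onI)
      fix a b assume ab: "a \<in> A" "b \<in> A"
        "(if a \<in> J then f1 a else f2 a) = (if b \<in> J then f1 b else f2 b)"
      have "f1 c \<in> U" if "c \<in> J" for c using that f1(2) U_def by blast
      moreover have "f2 c \<notin> U" if "c \<in> A" "c \<notin> J" for c using that f2(2) by blast
      ultimately show "a = b" using ab f1(1) f2(1)
        by (auto split: if_splits dest: inj_onD) metis+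
    qed
    then show ?thesis using f1(2) f2(2)
      by (intro exI[of _ "\<lambda>a. if a \<in> J then f1 a else f2 a"]) auto
  next
    case slack
    then obtain a where a: "a \<in> A" by blast
    have "card {a} \<le> card (\<Union>(N ` {a}))" using a by (intro hall) auto
    then obtain b where b: "b \<in> N a" by fastforce
    have "card (A - {a}) < card A" using a fin by (intro psubset_card_mono) auto
    then have "\<exists>f. inj_on f (A - {a}) \<and> (\<forall>c\<in>A - {a}. f c \<in> N c - {b})"
    proof (rule less.hyps)
      fix K assume K: "K \<subseteq> A - {a}"
      show "card K \<le> card (\<Union>c\<in>K. N c - {b})"
      proof (cases "K = {}")
        case False
        have "card K \<le> card (\<Union>(N ` K))" using K by (intro hall) auto
        moreover have "card (\<Union>(N ` K)) \<noteq> card K" using K a False by (intro slack(2)) auto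
        ultimately have "card K \<le> card (\<Union>(N ` K)) - 1" by linarith
        also have "\<dots> \<le> card (\<Union>(N ` K) - {b})"
          using diff_card_le_card_Diff[of "{b}" "\<Union>(N ` K)"] by simp
        also have "\<Union>(N ` K) - {b} = (\<Union>c\<in>K. N c - {b})" by auto
        finally show ?thesis .
      qed simp
    qed (use fin finN in auto)
    then obtain f where f: "inj_on f (A - {a})" "\<forall>c\<in>A - {a}. f c \<in> N c - {b}" by blast
    have "inj_on (f(a := b)) A" using f by (auto simp: inj_on_def)
    then show ?thesis using f(2) b by (intro exI[of _ "f(a := b)"]) auto
  qed
qed

section \<open>Permutations inside a relation\<close>

lemma hall_permutes:
  assumes fin: "finite S"
    and hall: "\<And>J. J \<subseteq> S \<Longrightarrow> card J \<le> card {y \<in> S. \<exists>x\<in>J. R x y}"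
  shows "\<exists>p. p permutes S \<and> (\<forall>x\<in>S. R x (p x))"
proof -
  have "\<exists>f. inj_on f S \<and> (\<forall>a\<in>S. f a \<in> {y \<in> S. R a y})"
  proof (rule hall_marriage[OF fin])
    fix J assume "J \<subseteq> S"
    moreover have "(\<Union>x\<in>J. {y \<in> S. R x y}) = {y \<in> S. \<exists>x\<in>J. R x y}" by auto
    ultimately show "card J \<le> card (\<Union>x\<in>J. {y \<in> S. R x y})" using hall by simp
  qed (use fin in auto)
  then obtain f where f: "inj_on f S" "\<forall>a\<in>S. f a \<in> S" "\<forall>a\<in>S. R a (f a)" by auto
  \<comment> \<open>\<open>permutes\<close> asks for the identity outside \<open>S\<close>.\<close>
  define p where "p = (\<lambda>x. if x \<in> S then f x else x)"
  have "f ` S = S" using f(1,2) fin by (intro endo_inj_surj) auto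
  then have "bij_betw p S S" using f(1) unfolding p_def bij_betw_def
    by (auto simp: inj_on_def)
  then have "p permutes S" by (rule bij_imp_permutes) (simp add: p_def)
  then show ?thesis using f(3) by (auto simp: p_def)
qed

text \<open>The \<open>card J * k\<close> pairs that leave \<open>J\<close> all end in
  \<open>M\<close>, and each point of \<open>M\<close> receives at most \<open>k\<close> of them;
  this is Hall's condition.\<close>

lemma regular_relation_permutes:
  assumes fin: "finite S" and k: "k > 0"
    and row: "\<And>x. x \<in> S \<Longrightarrow> card {y \<in> S. R x y} = k"
    and col: "\<And>y. y \<in> S \<Longrightarrow> card {x \<in> S. R x y} = k"
  shows "\<exists>p. p permutes S \<and> (\<forall>x\<in>S. R x (p x))"
proof (rule hall_permutes[OF fin])
  fix J assume J: "J \<subseteq> S"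
  define M where "M = {y \<in> S. \<exists>x\<in>J. R x y}"
  have finJ: "finite J" "finite M" using J fin finite_subset by (auto simp: M_def)
  have "card J * k = card (SIGMA x:J. {y \<in> S. R x y})"
    using finJ J row fin by (subst card_SigmaI) (auto simp: subset_iff)
  also have "\<dots> = card (prod.swap ` (SIGMA x:J. {y \<in> S. R x y}))"
    by (rule card_image[symmetric]) (auto simp: inj_on_def)
  also have "\<dots> \<le> card (SIGMA y:M. {x \<in> S. R x y})"
    using J fin finJ by (intro card_mono) (auto simp: M_def)
  also have "\<dots> = card M * k"
    using finJ col fin by (subst card_SigmaI) (auto simp: M_def)
  finally show "card J \<le> card {y \<in> S. \<exists>x\<in>J. R x y}" using k M_def by simp
qed

definition pointwise_disjoint :: "'a set \<Rightarrow> ('a \<Rightarrow> 'b) set \<Rightarrow> bool" where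
  "pointwise_disjoint S L \<longleftrightarrow> (\<forall>p\<in>L. \<forall>q\<in>L. p \<noteq> q \<longrightarrow> (\<forall>x\<in>S. p x \<noteq> q x))"

text \<open>Removing the graph of one permutation lowers every row and column degree by one, so
  permutations can be peeled off one at a time.\<close>

lemma regular_relation_factorization:
  assumes fin: "finite S" and ne: "S \<noteq> {}"
    and row: "\<And>x. x \<in> S \<Longrightarrow> card {y \<in> S. R x y} = k"
    and col: "\<And>y. y \<in> S \<Longrightarrow> card {x \<in> S. R x y} = k"
  shows "\<exists>L. card L = k \<and> finite L \<and> (\<forall>p\<in>L. p permutes S \<and> (\<forall>x\<in>S. R x (p x)))
    \<and> pointwise_disjoint S L"
  using row col
proof (induction k arbitrary: R)
  case 0
  then show ?case by (intro exI[of _ "{}"]) (auto simp: pointwise_disjoint_def)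
next
  case (Suc k)
  obtain p where p: "p permutes S" "\<forall>x\<in>S. R x (p x)"
    using regular_relation_permutes[OF fin _ Suc.prems] by auto
  have "\<exists>L. card L = k \<and> finite L \<and>
      (\<forall>q\<in>L. q permutes S \<and> (\<forall>x\<in>S. R x (q x) \<and> q x \<noteq> p x)) \<and> pointwise_disjoint S L"
  proof (rule Suc.IH)
    fix x assume x: "x \<in> S"
    have "{y \<in> S. R x y \<and> y \<noteq> p x} = {y \<in> S. R x y} - {p x}" by auto
    then show "card {y \<in> S. R x y \<and> y \<noteq> p x} = k"
      using Suc.prems(1)[OF x] p x by (simp add: permutes_in_image)
  next
    fix y assume y: "y \<in> S"
    have eq: "y \<noteq> p x \<longleftrightarrow> x \<noteq> inv p y" for x
      using permutes_inv_eq[OF p(1)] by metis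
    have "inv p y \<in> S" using p(1) y by (meson permutes_in_image permutes_inv)
    moreover have "R (inv p y) y" using p calculation by (metis permutes_inverses(1))
    moreover have "{x \<in> S. R x y \<and> y \<noteq> p x} = {x \<in> S. R x y} - {inv p y}"
      by (auto simp: eq)
    ultimately show "card {x \<in> S. R x y \<and> y \<noteq> p x} = k"
      using Suc.prems(2)[OF y] by simp
  qed
  then obtain L where L: "card L = k" "finite L" "pointwise_disjoint S L"
    "\<And>q. q \<in> L \<Longrightarrow> q permutes S" "\<And>q x. q \<in> L \<Longrightarrow> x \<in> S \<Longrightarrow> R x (q x) \<and> q x \<noteq> p x"
    by blast
  have "p \<notin> L" using L(5) ne by blast
  moreover have "pointwise_disjoint S (insert p L)"
    using L(3,5) unfolding pointwise_disjoint_def by (metis insert_iff)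
  ultimately show ?case using L p by (intro exI[of _ "insert p L"]) auto
qed

section \<open>Latin squares\<close>

definition latin :: "'a set \<Rightarrow> ('a \<Rightarrow> 'a) set \<Rightarrow> bool" where
  "latin S L \<longleftrightarrow> finite L \<and> card L = card S \<and> (\<forall>p\<in>L. p permutes S) \<and> pointwise_disjoint S L"

lemma latin_exists:
  assumes "finite S" "S \<noteq> {}"
  shows "\<exists>L. latin S L"
  using regular_relation_factorization[OF assms, of "\<lambda>_ _. True" "card S"]
  by (auto simp: latin_def)

text \<open>The complement of two disjoint permutation graphs is regular, hence
  factorizable, and the factorization does not depend on how the union of the two
  graphs was split.\<close>
lemma latin_switch:
  assumes fin: "finite S" and ne: "S \<noteq> {}"
    and perm: "\<sigma> permutes S" "\<tau> permutes S" "\<sigma>' permutes S" "\<tau>' permutes S"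
    and disj: "\<And>x. x \<in> S \<Longrightarrow> \<sigma> x \<noteq> \<tau> x"
    and eq: "\<And>x. x \<in> S \<Longrightarrow> {\<sigma> x, \<tau> x} = {\<sigma>' x, \<tau>' x}"
  shows "\<exists>R. \<sigma> \<notin> R \<and> \<tau> \<notin> R \<and> \<sigma>' \<notin> R \<and> \<tau>' \<notin> R \<and> finite R
    \<and> latin S ({\<sigma>, \<tau>} \<union> R) \<and> latin S ({\<sigma>', \<tau>'} \<union> R)"
proof -
  let ?R = "\<lambda>x y. y \<noteq> \<sigma> x \<and> y \<noteq> \<tau> x"
  obtain a where a: "a \<in> S" using ne by blast
  have disj': "\<sigma>' x \<noteq> \<tau>' x" if "x \<in> S" for x
    using disj[OF that] eq[OF that] by (auto simp: doubleton_eq_iff)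
  have row: "card {y \<in> S. ?R x y} = card S - 2" if x: "x \<in> S" for x
  proof -
    have "{y \<in> S. ?R x y} = S - {\<sigma> x, \<tau> x}" by auto
    moreover have "{\<sigma> x, \<tau> x} \<subseteq> S" using perm x by (simp add: permutes_in_image)
    ultimately show ?thesis using disj[OF x] fin by (simp add: card_Diff_subset)
  qed
  have col: "card {x \<in> S. ?R x y} = card S - 2" if y: "y \<in> S" for y
  proof -
    have "{x \<in> S. ?R x y} = S - {inv \<sigma> y, inv \<tau> y}"
      using perm(1,2) by (auto simp: permutes_inverses)
    moreover have "{inv \<sigma> y, inv \<tau> y} \<subseteq> S"
      using perm(1,2) y by (simp add: permutes_in_image permutes_inv)
    moreover have "inv \<sigma> y \<noteq> inv \<tau> y"
      using disj calculation(2) perm(1,2) by (metis insert_subset permutes_inverses(1))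
    ultimately show ?thesis using fin by (simp add: card_Diff_subset)
  qed
  obtain R where R: "card R = card S - 2" "finite R" "\<And>p. p \<in> R \<Longrightarrow> p permutes S"
    "\<And>p x. p \<in> R \<Longrightarrow> x \<in> S \<Longrightarrow> p x \<noteq> \<sigma> x \<and> p x \<noteq> \<tau> x" "pointwise_disjoint S R"
    using regular_relation_factorization[OF fin ne, of ?R "card S - 2", OF row col] by blast
  have R': "p x \<noteq> \<sigma>' x \<and> p x \<noteq> \<tau>' x" if "p \<in> R" "x \<in> S" for p x
    using R(4)[OF that] eq[OF that(2)] by (auto simp: doubleton_eq_iff)
  have nin: "\<sigma> \<notin> R" "\<tau> \<notin> R" "\<sigma>' \<notin> R" "\<tau>' \<notin> R" using R(4) R' a by blast+
  have neq: "\<sigma> \<noteq> \<tau>" "\<sigma>' \<noteq> \<tau>'" using disj disj' a by blast+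
  \<comment> \<open>Since \<open>S\<close> has two points, the truncated difference
    \<open>card S - 2\<close> plus the two added permutations is exactly
    \<open>card S\<close>.\<close>
  have "card {\<sigma> a, \<tau> a} \<le> card S" using perm a fin by (intro card_mono) (auto simp: permutes_in_image)
  then have S2: "card S \<ge> 2" using disj[OF a] by simp
  have "latin S ({\<sigma>, \<tau>} \<union> R)"
    unfolding latin_def
  proof (intro conjI)
    show "pointwise_disjoint S ({\<sigma>, \<tau>} \<union> R)"
      using R(4,5) disj unfolding pointwise_disjoint_def by (auto; metis)
  qed (use R nin neq perm S2 in auto)
  moreover have "latin S ({\<sigma>', \<tau>'} \<union> R)"
    unfolding latin_def
  proof (intro conjI)
    show "pointwise_disjoint S ({\<sigma>', \<tau>'} \<union> R)"
      using R(5) R' disj' unfolding pointwise_disjoint_def by (auto; metis)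
  qed (use R nin neq perm S2 in auto)
  ultimately show ?thesis using nin R(2) by blast
qed

section \<open>Exchange of disjoint transpositions\<close>

lemma permutes_disjoint_commute:
  assumes "p permutes U" "q permutes V" "U \<inter> V = {}"
  shows "p \<circ> q = q \<circ> p"
proof
  fix x
  have "x \<notin> U \<or> x \<notin> V" using assms(3) by blast
  moreover have "p x \<in> U \<longleftrightarrow> x \<in> U" "q x \<in> V \<longleftrightarrow> x \<in> V"
    using assms by (auto simp: permutes_in_image)
  ultimately show "(p \<circ> q) x = (q \<circ> p) x"
    using assms permutes_not_in[OF assms(1)] permutes_not_in[OF assms(2)]
    by (metis comp_apply disjoint_iff)
qed

text \<open>The two Latin squares share the remainder \<open>R\<close>, whose contribution
  cancels.\<close>

lemma switch_sum:
  fixes f :: "('a \<Rightarrow> 'a) \<Rightarrow> int"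
  assumes const: "\<And>L. latin S L \<Longrightarrow> sum f L = C"
    and fin: "finite S" and ne: "S \<noteq> {}"
    and perm: "\<sigma> permutes S" "\<tau> permutes S" "\<sigma>' permutes S" "\<tau>' permutes S"
    and disj: "\<And>x. x \<in> S \<Longrightarrow> \<sigma> x \<noteq> \<tau> x"
    and eq: "\<And>x. x \<in> S \<Longrightarrow> {\<sigma> x, \<tau> x} = {\<sigma>' x, \<tau>' x}"
  shows "f \<sigma> + f \<tau> = f \<sigma>' + f \<tau>'"
proof -
  obtain R where R: "\<sigma> \<notin> R" "\<tau> \<notin> R" "\<sigma>' \<notin> R" "\<tau>' \<notin> R" "finite R"
    "latin S ({\<sigma>, \<tau>} \<union> R)" "latin S ({\<sigma>', \<tau>'} \<union> R)"
    using latin_switch[OF fin ne perm disj eq] by blast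
  obtain a where a: "a \<in> S" using ne by blast
  have "\<sigma> \<noteq> \<tau>" "\<sigma>' \<noteq> \<tau>'" using disj[OF a] eq[OF a] by (auto simp: doubleton_eq_iff)
  then have "f \<sigma> + f \<tau> + sum f R = sum f ({\<sigma>, \<tau>} \<union> R)"
    and "f \<sigma>' + f \<tau>' + sum f R = sum f ({\<sigma>', \<tau>'} \<union> R)" using R(1-5) by auto
  then show ?thesis using const[OF R(6)] const[OF R(7)] by simp
qed

text \<open>Each point of \<open>S\<close> is moved by exactly one of \<open>p\<close> and
  \<open>q\<close>. Hence \<open>\<rho>\<close> and \<open>\<rho> \<circ> p \<circ> q\<close> are
  disjoint, and \<open>\<rho> \<circ> p\<close> and \<open>\<rho> \<circ> q\<close> together cover
  the same cells.\<close>

lemma split_exchange: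
  fixes f :: "('a \<Rightarrow> 'a) \<Rightarrow> int"
  assumes const: "\<And>L. latin S L \<Longrightarrow> sum f L = C"
    and fin: "finite S" and ne: "S \<noteq> {}"
    and part: "S = U \<union> V" "U \<inter> V = {}"
    and perm: "\<rho> permutes S" "p permutes U" "q permutes V"
    and der: "\<And>x. x \<in> U \<Longrightarrow> p x \<noteq> x" "\<And>x. x \<in> V \<Longrightarrow> q x \<noteq> x"
  shows "f \<rho> + f (\<rho> \<circ> p \<circ> q) = f (\<rho> \<circ> p) + f (\<rho> \<circ> q)"
proof (rule switch_sum[OF const fin ne])
  have pS: "p permutes S" and qS: "q permutes S"
    using perm part by (auto intro: permutes_subset)
  show "\<rho> permutes S" "\<rho> \<circ> p \<circ> q permutes S" "\<rho> \<circ> p permutes S" "\<rho> \<circ> q permutes S"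
    using perm(1) pS qS by (auto intro!: permutes_compose)
  have inj: "\<rho> x = \<rho> y \<longleftrightarrow> x = y" for x y using perm(1) by (metis permutes_inverses(2))
  fix x assume x: "x \<in> S"
  have pq: "p (q x) = (if x \<in> U then p x else q x)"
    using x part permutes_not_in[OF perm(2)] permutes_not_in[OF perm(3)] permutes_in_image[OF perm(3)]
    by (metis Un_iff disjoint_iff)
  have "p (q x) \<noteq> x" using x part der pq by (metis Un_iff)
  then show "\<rho> x \<noteq> (\<rho> \<circ> p \<circ> q) x" by (metis comp_apply inj)
  show "{\<rho> x, (\<rho> \<circ> p \<circ> q) x} = {(\<rho> \<circ> p) x, (\<rho> \<circ> q) x}"
    using x part perm(2,3) by (auto simp: pq permutes_not_in disjoint_iff)
qed

text \<open>Hall's condition holds because each position forbids at most two values, which leaves at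
  least two, and each value is forbidden at no more than two positions, so three positions together
  admit all of \<open>U\<close>.\<close>

lemma derangement_avoiding_transposition:
  assumes fin: "finite U" and card: "card U \<ge> 4" and ij: "i \<in> U" "j \<in> U"
  shows "\<exists>c. c permutes U \<and> (\<forall>x\<in>U. c x \<noteq> x \<and> c x \<noteq> transpose i j x)"
proof -
  have "\<exists>c. c permutes U \<and> (\<forall>x\<in>U. \<not> (c x = x \<or> c x = transpose i j x))"
  proof (rule hall_permutes[OF fin])
    fix J assume J: "J \<subseteq> U"
    let ?M = "{y \<in> U. \<exists>x\<in>J. \<not> (y = x \<or> y = transpose i j x)}"
    have two: "card {y, transpose i j y} \<le> 2" for y by (simp add: card_insert_if)
    consider "J = {}" | x where "x \<in> J" "card J \<le> 2" | "card J > 2" by fastforce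
    then show "card J \<le> card ?M"
    proof cases
      case 2
      have "card U - card {x, transpose i j x} \<le> card (U - {x, transpose i j x})"
        by (rule diff_card_le_card_Diff) simp
      also have "\<dots> \<le> card ?M" using fin 2(1) by (intro card_mono) auto
      finally show ?thesis using two[of x] card 2(2) by linarith
    next
      case 3
      have "U \<subseteq> ?M"
      proof
        fix y assume y: "y \<in> U"
        have "\<not> J \<subseteq> {y, transpose i j y}"
          using card_mono[of "{y, transpose i j y}" J] two[of y] 3 by auto
        then show "y \<in> ?M" using y by auto
      qed
      then have "?M = U" by auto
      then show ?thesis using J fin by (simp add: card_mono)
    qed simp
  qed
  then show ?thesis by simp
qed

text \<open>A transposition fixes most points, so \<open>split_exchange\<close> does not apply to it
  directly; it is instead the quotient of the derangements \<open>c\<close> and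
  \<open>c \<circ> a\<close> of a set \<open>U\<close>. In the alternating sum of four instances of
  \<open>split_exchange\<close> all terms cancel except the four wanted ones. The bound 8 leaves
  four points for each of \<open>U\<close> and \<open>V\<close>.\<close>

lemma transposition_exchange:
  fixes f :: "('a \<Rightarrow> 'a) \<Rightarrow> int"
  assumes const: "\<And>L. latin S L \<Longrightarrow> sum f L = C"
    and fin: "finite S" and card: "card S \<ge> 8"
    and \<sigma>: "\<sigma> permutes S" and ijkl: "{i, j, k, l} \<subseteq> S" "distinct [i, j, k, l]"
  shows "f \<sigma> + f (\<sigma> \<circ> transpose i j \<circ> transpose k l)
    = f (\<sigma> \<circ> transpose i j) + f (\<sigma> \<circ> transpose k l)"
proof -
  have "card (S - {i, j, k, l}) \<ge> 2" using fin card ijkl by (subst card_Diff_subset) auto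
  then obtain T where T: "T \<subseteq> S - {i, j, k, l}" "card T = 2" "finite T"
    by (meson obtain_subset_with_card_n)
  define U V where "U = {i, j} \<union> T" and "V = S - U"
  have U: "finite U" "card U = 4" "i \<in> U" "j \<in> U"
    using T ijkl by (auto simp: U_def card_insert_if)
  have US: "U \<subseteq> S" using T ijkl by (auto simp: U_def)
  have V: "finite V" "card V \<ge> 4" "k \<in> V" "l \<in> V"
    using U(1,2) US fin card T ijkl by (auto simp: V_def U_def card_Diff_subset)
  have part: "S = U \<union> V" "U \<inter> V = {}" using US by (auto simp: V_def)
  have ne: "S \<noteq> {}" using ijkl by auto
  define a b where "a = transpose i j" and "b = transpose k l"
  have aU: "a permutes U" and bV: "b permutes V"
    using U V by (auto simp: a_def b_def intro: permutes_swap_id)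
  obtain c where c: "c permutes U" "\<And>x. x \<in> U \<Longrightarrow> c x \<noteq> x" "\<And>x. x \<in> U \<Longrightarrow> c x \<noteq> a x"
    using derangement_avoiding_transposition[of U i j] U unfolding a_def by auto
  obtain d where d: "d permutes V" "\<And>x. x \<in> V \<Longrightarrow> d x \<noteq> x" "\<And>x. x \<in> V \<Longrightarrow> d x \<noteq> b x"
    using derangement_avoiding_transposition[of V k l] V unfolding b_def by auto
  have ca: "c \<circ> a permutes U" and db: "d \<circ> b permutes V"
    using c d aU bV by (auto intro: permutes_compose)
  \<comment> \<open>As \<open>a\<close> is an involution, \<open>c (a x) = x\<close> would mean that
    \<open>c\<close> and \<open>a\<close> agree at \<open>a x\<close>.\<close>
  have ca': "(c \<circ> a) x \<noteq> x" if "x \<in> U" for x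
    using c(3)[of "a x"] that aU by (simp add: permutes_in_image a_def)
  have db': "(d \<circ> b) x \<noteq> x" if "x \<in> V" for x
    using d(3)[of "b x"] that bV by (simp add: permutes_in_image b_def)
  have cd: "c \<circ> d permutes S"
    using c(1) d(1) part by (metis permutes_compose permutes_subset sup_ge1 sup_ge2)
  \<comment> \<open>With this base point, \<open>\<sigma>\<close>, \<open>\<sigma> \<circ> a\<close>, \<open>\<sigma> \<circ> b\<close> and \<open>\<sigma> \<circ> a \<circ> b\<close> are the products of \<open>\<rho>\<close> with a
    derangement of \<open>U\<close> (\<open>c\<close> or \<open>c \<circ> a\<close>) and one of \<open>V\<close> (\<open>d\<close> or \<open>d \<circ> b\<close>).\<close>
  define \<rho> where "\<rho> = \<sigma> \<circ> inv (c \<circ> d)"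
  have \<rho>: "\<rho> permutes S" unfolding \<rho>_def
    by (rule permutes_compose[OF permutes_inv[OF cd] \<sigma>])
  have ex: "f \<rho> + f (\<rho> \<circ> p \<circ> q) = f (\<rho> \<circ> p) + f (\<rho> \<circ> q)"
    if "p permutes U" "q permutes V" "\<And>x. x \<in> U \<Longrightarrow> p x \<noteq> x" "\<And>x. x \<in> V \<Longrightarrow> q x \<noteq> x" for p q
    by (rule split_exchange[OF const fin ne part \<rho> that])
  have inv: "inv (c \<circ> d) \<circ> (c \<circ> d) = id" using cd by (rule permutes_inv_o(2))
  have 1: "\<rho> \<circ> c \<circ> d = \<sigma>" using inv by (simp add: \<rho>_def comp_assoc)
  have ad: "a \<circ> d = d \<circ> a" using permutes_disjoint_commute[OF aU d(1) part(2)] .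
  have "\<rho> \<circ> (c \<circ> a) \<circ> d = \<rho> \<circ> c \<circ> (a \<circ> d)" by (simp add: comp_assoc)
  also have "\<dots> = \<rho> \<circ> c \<circ> d \<circ> a" by (simp add: ad comp_assoc)
  finally have 2: "\<rho> \<circ> (c \<circ> a) \<circ> d = \<sigma> \<circ> a" using 1 by simp
  have 3: "\<rho> \<circ> c \<circ> (d \<circ> b) = \<sigma> \<circ> b" using 1 by (metis comp_assoc)
  have 4: "\<rho> \<circ> (c \<circ> a) \<circ> (d \<circ> b) = \<sigma> \<circ> a \<circ> b" using 2 by (metis comp_assoc)
  have "f (\<sigma>) + f (\<sigma> \<circ> a \<circ> b) = f (\<sigma> \<circ> a) + f (\<sigma> \<circ> b)"
    using ex[OF c(1) d(1) c(2) d(2)] ex[OF ca d(1) ca' d(2)]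
      ex[OF c(1) db c(2) db'] ex[OF ca db ca' db'] unfolding 1 2 3 4 by simp
  then show ?thesis by (simp add: a_def b_def)
qed

section \<open>Matrices of mixed differences\<close>

text \<open>The mixed second difference; it vanishes throughout exactly when the matrix is a
  function of the row plus a function of the column.\<close>

definition rect :: "('a \<Rightarrow> 'b \<Rightarrow> int) \<Rightarrow> 'a \<Rightarrow> 'a \<Rightarrow> 'b \<Rightarrow> 'b \<Rightarrow> int" where
  "rect a i j x y = a i x - a i y - a j x + a j y"

lemma rect_transpose: "rect (\<lambda>x i. a i x) x y i j = rect a i j x y"
  by (simp add: rect_def)

definition rects_meet :: "'a set \<Rightarrow> 'b set \<Rightarrow> ('a \<Rightarrow> 'b \<Rightarrow> int) \<Rightarrow> bool" where
  "rects_meet I X a \<longleftrightarrow> (\<forall>i j k l x y z w. {i, j, k, l} \<subseteq> I \<longrightarrow> {x, y, z, w} \<subseteq> X \<longrightarrow>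
    distinct [i, j, k, l] \<longrightarrow> distinct [x, y, z, w] \<longrightarrow> rect a i j x y = 0 \<or> rect a k l z w = 0)"

text \<open>Phrased through the rectangles that avoid \<open>r\<close>: these are the swaps later
  shown to leave the Boolean function unchanged.\<close>

definition rects_share_row :: "'a set \<Rightarrow> 'b set \<Rightarrow> ('a \<Rightarrow> 'b \<Rightarrow> int) \<Rightarrow> bool" where
  "rects_share_row I X a \<longleftrightarrow>
    (\<exists>r\<in>I. \<forall>i\<in>I - {r}. \<forall>j\<in>I - {r}. \<forall>x\<in>X. \<forall>y\<in>X. rect a i j x y = 0)"

definition rects_share_col :: "'a set \<Rightarrow> 'b set \<Rightarrow> ('a \<Rightarrow> 'b \<Rightarrow> int) \<Rightarrow> bool" where
  "rects_share_col I X a \<longleftrightarrow>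
    (\<exists>c\<in>X. \<forall>i\<in>I. \<forall>j\<in>I. \<forall>x\<in>X - {c}. \<forall>y\<in>X - {c}. rect a i j x y = 0)"

lemma rects_meetD:
  assumes "rects_meet I X a" "{i, j, k, l} \<subseteq> I" "{x, y, z, w} \<subseteq> X"
    "distinct [i, j, k, l]" "distinct [x, y, z, w]"
  shows "rect a i j x y = 0 \<or> rect a k l z w = 0"
  using assms unfolding rects_meet_def by blast

section \<open>Location of the nonzero rectangles\<close>

lemma ex_outside:
  assumes "finite X" "card X \<ge> 5"
  shows "\<exists>v\<in>X. v \<noteq> p \<and> v \<noteq> q \<and> v \<noteq> r \<and> v \<noteq> s"
proof -
  have "card {p, q, r, s} \<le> 4" by (simp add: card_insert_if)
  then have "\<not> X \<subseteq> {p, q, r, s}" using assms card_mono[of "{p, q, r, s}" X] by auto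
  then show ?thesis by blast
qed

text \<open>Pairs on which \<open>A\<close> differs meet all pairs on which \<open>B\<close>
  differs. Two pairs of the first kind share a point \<open>w\<close> and force \<open>B\<close> to
  be constant off \<open>w\<close>. As \<open>B\<close> is not constant, it differs on every pair
  through \<open>w\<close>, which in turn makes \<open>A\<close> constant off
  \<open>w\<close>.\<close>

lemma const_off_common_point:
  fixes A B :: "'b \<Rightarrow> int"
  assumes fin: "finite X" and card: "card X \<ge> 5"
    and meet: "\<And>x y z w. {x, y, z, w} \<subseteq> X \<Longrightarrow> distinct [x, y, z, w] \<Longrightarrow> A x = A y \<or> B z = B w"
    and A: "x0 \<in> X" "y0 \<in> X" "A x0 \<noteq> A y0" and B: "u0 \<in> X" "v0 \<in> X" "B u0 \<noteq> B v0"
  shows "\<exists>c\<in>X. \<forall>x\<in>X - {c}. \<forall>y\<in>X - {c}. A x = A y \<and> B x = B y"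
proof -
  obtain v where v: "v \<in> X" "v \<noteq> x0" "v \<noteq> y0" using ex_outside[OF fin card] by metis
  \<comment> \<open>\<open>w\<close> is whichever of \<open>x0\<close> and \<open>y0\<close> has an
    \<open>A\<close>-value different from that of \<open>v\<close>, and \<open>z\<close> is the
    other one.\<close>
  obtain w z where w: "w \<in> X" "z \<in> X" "v \<noteq> w" "v \<noteq> z" "A z \<noteq> A w" "A v \<noteq> A w"
    using A v by metis
  then have zw: "z \<noteq> w" by blast
  obtain t where t: "t \<in> X" "t \<noteq> z" "t \<noteq> w" "t \<noteq> v" using ex_outside[OF fin card] by metis
  have Bt: "B x = B t" if "x \<in> X" "x \<noteq> w" for x
  proof (cases "x = t")
    case False
    show ?thesis
    proof (cases "x = z")
      case True
      then show ?thesis using meet[of v w x t] v w t zw that by auto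
    next
      case xz: False
      then show ?thesis using meet[of z w x t] w t zw that False by auto
    qed
  qed simp
  have Bw: "B w \<noteq> B x" if "x \<in> X" "x \<noteq> w" for x
    using Bt[OF that] Bt[of u0] Bt[of v0] B by metis
  have "A x = A y" if "x \<in> X" "y \<in> X" "x \<noteq> w" "y \<noteq> w" for x y
  proof (cases "x = y")
    case False
    obtain s where s: "s \<in> X" "s \<noteq> x" "s \<noteq> y" "s \<noteq> w" using ex_outside[OF fin card] by metis
    then show ?thesis using meet[of x y w s] Bw[of s] that w False by auto
  qed simp
  then show ?thesis using Bt w(1) by (intro bexI[of _ w]) auto
qed

text \<open>Rows other than \<open>i\<close> and \<open>j\<close> agree up to constants, so only
  their differences \<open>A\<close> and \<open>B\<close> from rows \<open>i\<close> and
  \<open>j\<close> matter. If one of these is constant, the other row carries all nonzero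
  rectangles; if neither is, \<open>const_off_common_point\<close> yields a column.\<close>

lemma rects_share_if_parallel_rows:
  assumes fin: "finite I" "finite X" and card: "card I \<ge> 5" "card X \<ge> 5"
    and meet: "rects_meet I X a" and ij: "i \<in> I" "j \<in> I" "i \<noteq> j"
    and par: "\<And>k l v w. k \<in> I - {i, j} \<Longrightarrow> l \<in> I - {i, j} \<Longrightarrow> v \<in> X \<Longrightarrow> w \<in> X \<Longrightarrow> rect a k l v w = 0"
  shows "rects_share_row I X a \<or> rects_share_col I X a"
proof -
  obtain k where k: "k \<in> I" "k \<noteq> i" "k \<noteq> j" using ex_outside[OF fin(1) card(1)] by metis
  obtain l where l: "l \<in> I" "l \<noteq> i" "l \<noteq> j" "l \<noteq> k" using ex_outside[OF fin(1) card(1)] by metis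
  define A B where "A = (\<lambda>v. a i v - a k v)" and "B = (\<lambda>v. a j v - a k v)"
  have row: "\<exists>g. \<forall>v\<in>X. a m v = a k v + g" if "m \<in> I - {i, j}" for m
  proof -
    obtain v0 where "v0 \<in> X" using ex_outside[OF fin(2) card(2)] by metis
    then have "a m v = a k v + (a m v0 - a k v0)" if "v \<in> X" for v
      using par[of m k v v0] \<open>m \<in> I - {i, j}\<close> that k by (simp add: rect_def)
    then show ?thesis by blast
  qed
  have AB: "A x = A y \<or> B z = B w" if "{x, y, z, w} \<subseteq> X" "distinct [x, y, z, w]" for x y z w
  proof -
    \<comment> \<open>\<open>rects_meet\<close> needs four distinct rows; since \<open>l\<close> is
      parallel to \<open>k\<close>, it can be replaced by \<open>k\<close> afterwards.\<close>
    have "rect a i k x y = 0 \<or> rect a j l z w = 0"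
      using rects_meetD[OF meet _ that(1) _ that(2), of i k j l] ij k l by auto
    moreover have "rect a l k z w = 0" using par[of l k z w] k l that by auto
    ultimately show ?thesis by (auto simp: A_def B_def rect_def)
  qed
  have rest: "rect a m m' x y = 0"
    if "x \<in> X" "y \<in> X" "m \<in> I" "m' \<in> I" "m \<noteq> i \<and> m' \<noteq> i \<or> A x = A y" "m \<noteq> j \<and> m' \<noteq> j \<or> B x = B y"
    for m m' x y
  proof -
    have "a m x - a m y = a k x - a k y" if m: "m \<in> I" "m \<noteq> i \<or> A x = A y" "m \<noteq> j \<or> B x = B y" for m
    proof (cases "m \<in> {i, j}")
      case True
      then show ?thesis using m by (auto simp: A_def B_def)
    next
      case False
      then obtain g where "\<forall>v\<in>X. a m v = a k v + g" using row m by blast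
      then show ?thesis using \<open>x \<in> X\<close> \<open>y \<in> X\<close> by simp
    qed
    from this[of m] this[of m'] that show ?thesis by (auto simp: rect_def)
  qed
  consider (A) "\<forall>x\<in>X. \<forall>y\<in>X. A x = A y" | (B) "\<forall>x\<in>X. \<forall>y\<in>X. B x = B y"
    | (nonconst) x0 y0 u0 v0 where "x0 \<in> X" "y0 \<in> X" "A x0 \<noteq> A y0" "u0 \<in> X" "v0 \<in> X" "B u0 \<noteq> B v0"
    by metis
  then show ?thesis
  proof cases
    case A
    have "rects_share_row I X a" unfolding rects_share_row_def
      by (intro bexI[of _ j] ballI rest) (use A ij in blast)+
    then show ?thesis ..
  next
    case B
    have "rects_share_row I X a" unfolding rects_share_row_def
      by (intro bexI[of _ i] ballI rest) (use B ij in blast)+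
    then show ?thesis ..
  next
    case nonconst
    have "\<exists>c\<in>X. \<forall>x\<in>X - {c}. \<forall>y\<in>X - {c}. A x = A y \<and> B x = B y"
      by (rule const_off_common_point[OF fin(2) card(2) AB nonconst])
    then obtain c where c: "c \<in> X" "\<forall>x\<in>X - {c}. \<forall>y\<in>X - {c}. A x = A y \<and> B x = B y" by blast
    have "rects_share_col I X a" unfolding rects_share_col_def
      by (intro bexI[of _ c] ballI rest) (use c in blast)+
    then show ?thesis ..
  qed
qed

text \<open>Fix a nonzero rectangle on rows \<open>i\<close>, \<open>j\<close> and columns
  \<open>x\<close>, \<open>y\<close>; off these lines everything vanishes. A nonzero rectangle with
  exactly one row in \<open>{i, j}\<close> and both columns off \<open>{x, y}\<close> makes all rows
  other than \<open>i\<close>, \<open>j\<close> parallel. If there is none, all columns other than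
  \<open>x\<close>, \<open>y\<close> are parallel, and the same lemma applies to the transposed
  matrix.\<close>

lemma rects_share:
  fixes a :: "'a \<Rightarrow> 'b \<Rightarrow> int"
  assumes fin: "finite I" "finite X" and card: "card I \<ge> 5" "card X \<ge> 5"
    and meet: "rects_meet I X a"
  shows "rects_share_row I X a \<or> rects_share_col I X a"
proof (cases "\<forall>i\<in>I. \<forall>j\<in>I. \<forall>x\<in>X. \<forall>y\<in>X. rect a i j x y = 0")
  case True
  moreover have "I \<noteq> {}" using card by auto
  ultimately show ?thesis by (auto simp: rects_share_row_def)
next
  case False
  then obtain i j x y where nz: "i \<in> I" "j \<in> I" "x \<in> X" "y \<in> X" "rect a i j x y \<noteq> 0" by blast
  then have neq: "i \<noteq> j" "x \<noteq> y" by (auto simp: rect_def)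
  have core: "rect a k l z w = 0"
    if "k \<in> I - {i, j}" "l \<in> I - {i, j}" "z \<in> X - {x, y}" "w \<in> X - {x, y}" for k l z w
  proof (cases "k = l \<or> z = w")
    case False
    then show ?thesis using rects_meetD[OF meet, of i j k l x y z w] nz neq that by auto
  qed (auto simp: rect_def)
  show ?thesis
  proof (cases "\<exists>m\<in>{i, j}. \<exists>k\<in>I - {i, j}. \<exists>z\<in>X - {x, y}. \<exists>w\<in>X - {x, y}. rect a m k z w \<noteq> 0")
    case True
    then obtain m k z w where m: "m \<in> {i, j}" "k \<in> I - {i, j}" "z \<in> X - {x, y}" "w \<in> X - {x, y}"
      "rect a m k z w \<noteq> 0" by blast
    then have zw: "z \<noteq> w" by (auto simp: rect_def)
    have mk: "rect a m k' z w \<noteq> 0" if "k' \<in> I - {i, j}" for k'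
      using core[OF m(2) that m(3,4)] m(5) by (auto simp: rect_def)
    have off: "rect a p q u v = 0"
      if "p \<in> I - {i, j}" "q \<in> I - {i, j}" "u \<in> X - {z, w}" "v \<in> X - {z, w}" for p q u v
    proof (cases "p = q \<or> u = v")
      case False
      \<comment> \<open>By \<open>mk\<close> the second row of the nonzero rectangle may be any row
        outside \<open>{i, j}\<close>, so it can be moved away from \<open>p\<close> and
        \<open>q\<close>.\<close>
      obtain k' where k': "k' \<in> I" "k' \<noteq> i" "k' \<noteq> j" "k' \<noteq> p" "k' \<noteq> q"
        using ex_outside[OF fin(1) card(1)] by metis
      then show ?thesis
        using rects_meetD[OF meet, of m k' p q z w u v] mk[of k'] False that m nz zw by auto
    qed (auto simp: rect_def)
    \<comment> \<open>A column outside both exceptional pairs: every column can be compared with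
      \<open>t\<close> by \<open>core\<close> or by \<open>off\<close>.\<close>
    obtain t where t: "t \<in> X" "t \<noteq> x" "t \<noteq> y" "t \<noteq> z" "t \<noteq> w"
      using ex_outside[OF fin(2) card(2)] by metis
    have "rect a p q u v = 0"
      if pq: "p \<in> I - {i, j}" "q \<in> I - {i, j}" and uv: "u \<in> X" "v \<in> X" for p q u v
    proof -
      have "rect a p q u t = 0" if "u \<in> X" for u
      proof (cases "u \<in> {x, y}")
        case True
        then show ?thesis using off[OF pq, of u t] t that m by auto
      next
        case False
        then show ?thesis using core[OF pq, of u t] t that by auto
      qed
      from this[OF uv(1)] this[OF uv(2)] show ?thesis by (simp add: rect_def)
    qed
    then show ?thesis
      by (intro rects_share_if_parallel_rows[OF fin card meet nz(1,2) neq(1)]) auto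
  next
    case False
    let ?b = "\<lambda>v p. a p v"
    have meet': "rects_meet X I ?b"
      unfolding rects_meet_def rect_transpose[of a] by (intro allI impI rects_meetD[OF meet])
    obtain k where k: "k \<in> I" "k \<noteq> i" "k \<noteq> j" using ex_outside[OF fin(1) card(1)] by metis
    \<comment> \<open>On columns off \<open>{x, y}\<close> every row is parallel to
      \<open>k\<close>, hence any two rows are.\<close>
    have pk: "rect a p k z w = 0" if "p \<in> I" "z \<in> X - {x, y}" "w \<in> X - {x, y}" for p z w
      using False core[of p k z w] k that by (cases "p \<in> {i, j}") auto
    have "rect ?b z w p q = 0"
      if "z \<in> X - {x, y}" "w \<in> X - {x, y}" "p \<in> I" "q \<in> I" for z w p q
      using pk[of p z w] pk[of q z w] that by (simp add: rect_def)
    then have "rects_share_row X I ?b \<or> rects_share_col X I ?b"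
      by (intro rects_share_if_parallel_rows[OF fin(2,1) card(2,1) meet' nz(3,4) neq(2)]) auto
    then show ?thesis
      unfolding rects_share_row_def rects_share_col_def rect_transpose[of a] by blast
  qed
qed

section \<open>Boolean functions additive on disjoint transpositions\<close>

text \<open>Positions are fixed one by one: swapping the values \<open>\<sigma> i\<close> and
  \<open>x\<close> leaves the earlier positions alone, because they take neither value.\<close>

lemma permutes_extending:
  assumes "length is = length xs" "distinct is" "distinct xs" "set is \<subseteq> S" "set xs \<subseteq> S"
  shows "\<exists>\<sigma>. \<sigma> permutes S \<and> map \<sigma> is = xs"
  using assms
proof (induction "is" xs rule: list_induct2)
  case Nil
  then show ?case using permutes_id by (metis list.map(1))
next
  case (Cons i "is" x xs)
  then obtain \<sigma> where \<sigma>: "\<sigma> permutes S" "map \<sigma> is = xs" by auto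
  have inS: "i \<in> S" "x \<in> S" using Cons.prems by auto
  let ?\<tau> = "transpose (\<sigma> i) x \<circ> \<sigma>"
  have "?\<tau> permutes S" using \<sigma>(1) inS
    by (intro permutes_compose permutes_swap_id) (auto simp: permutes_in_image)
  moreover have "?\<tau> j = \<sigma> j" if "j \<in> set is" for j
  proof -
    have "\<sigma> j \<noteq> \<sigma> i" using \<sigma>(1) that Cons.prems by (metis distinct.simps(2) permutes_inverses(2))
    moreover have "\<sigma> j \<noteq> x" using \<sigma>(2) that Cons.prems by auto
    ultimately show ?thesis by simp
  qed
  then have "map ?\<tau> is = xs" using \<sigma>(2) by (metis map_cong)
  then have "map ?\<tau> (i # is) = x # xs"
    by (simp only: list.map comp_apply transpose_apply_first)
  ultimately show ?case by (intro exI[of _ ?\<tau>] conjI)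
qed

text \<open>The identity says that the change of \<open>f\<close> under the swap of \<open>i\<close>
  and \<open>j\<close> is not affected by first swapping two other positions.\<close>

locale transposition_additive =
  fixes S :: "'a set" and f :: "('a \<Rightarrow> 'a) \<Rightarrow> int"
  assumes fin: "finite S" and card_ge: "card S \<ge> 5"
    and exchange: "\<And>\<sigma> i j k l. \<sigma> permutes S \<Longrightarrow> {i, j, k, l} \<subseteq> S \<Longrightarrow> distinct [i, j, k, l] \<Longrightarrow>
      f \<sigma> + f (\<sigma> \<circ> transpose i j \<circ> transpose k l)
        = f (\<sigma> \<circ> transpose i j) + f (\<sigma> \<circ> transpose k l)"
begin

section \<open>The change of \<open>f\<close> under one swap\<close>

lemma permutes_swap:
  assumes "\<sigma> permutes S" "i \<in> S" "j \<in> S"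
  shows "\<sigma> \<circ> transpose i j permutes S"
  using assms by (intro permutes_compose permutes_swap_id)

text \<open>\<open>\<sigma>\<close> and \<open>\<tau>\<close> differ by a permutation of
  \<open>S - {i, j}\<close>, a product of transpositions to each of which \<open>exchange\<close>
  applies.\<close>

lemma swap_diff_cong:
  assumes \<sigma>: "\<sigma> permutes S" and \<tau>: "\<tau> permutes S" and ij: "i \<in> S" "j \<in> S"
    and eq: "\<sigma> i = \<tau> i" "\<sigma> j = \<tau> j"
  shows "f \<sigma> - f (\<sigma> \<circ> transpose i j) = f \<tau> - f (\<tau> \<circ> transpose i j)"
proof (cases "i = j")
  case False
  have step: "f (\<rho> \<circ> \<pi>) - f (\<rho> \<circ> \<pi> \<circ> transpose i j) = f \<rho> - f (\<rho> \<circ> transpose i j)"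
    if "\<pi> permutes S - {i, j}" "\<rho> permutes S" for \<pi> \<rho>
  proof -
    have "finite (S - {i, j})" using fin by simp
    \<comment> \<open>The base point is quantified because each transposition peeled off is absorbed
      into \<open>\<rho>\<close>.\<close>
    with that(1) have "\<forall>\<rho>. \<rho> permutes S \<longrightarrow>
      f (\<rho> \<circ> \<pi>) - f (\<rho> \<circ> \<pi> \<circ> transpose i j) = f \<rho> - f (\<rho> \<circ> transpose i j)"
    proof (induction rule: permutes_induct)
      case id
      then show ?case by simp
    next
      case (swap a b p)
      have "f (\<rho> \<circ> (transpose a b \<circ> p)) - f (\<rho> \<circ> (transpose a b \<circ> p) \<circ> transpose i j)
          = f \<rho> - f (\<rho> \<circ> transpose i j)" if \<rho>: "\<rho> permutes S" for \<rho>
      proof -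
        have "\<rho> \<circ> transpose a b permutes S" using \<rho> swap.hyps by (intro permutes_swap) auto
        then have "f (\<rho> \<circ> transpose a b \<circ> p) - f (\<rho> \<circ> transpose a b \<circ> p \<circ> transpose i j)
            = f (\<rho> \<circ> transpose a b) - f (\<rho> \<circ> transpose a b \<circ> transpose i j)"
          using swap.IH by blast
        also have "\<dots> = f \<rho> - f (\<rho> \<circ> transpose i j)"
          using exchange[OF \<rho>, of a b i j] swap.hyps ij False by auto
        finally show ?thesis by (simp add: comp_assoc)
      qed
      then show ?case by blast
    qed
    then show ?thesis using that(2) by blast
  qed
  define \<pi> where "\<pi> = inv \<sigma> \<circ> \<tau>"
  have "\<pi> permutes S" unfolding \<pi>_def using \<sigma> \<tau> by (intro permutes_compose permutes_inv)
  moreover have "\<pi> i = i" "\<pi> j = j"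
    using eq[symmetric] permutes_inverses(2)[OF \<sigma>] by (auto simp: \<pi>_def)
  ultimately have "\<pi> permutes S - {i, j}" by (auto intro: permutes_superset)
  moreover have "\<tau> = \<sigma> \<circ> \<pi>" unfolding \<pi>_def by (auto simp: fun_eq_iff permutes_inverses[OF \<sigma>])
  ultimately show ?thesis using step[of \<pi> \<sigma>] \<sigma> by simp
qed simp

text \<open>On \<open>S\<close> the choice of \<open>\<sigma>\<close> is immaterial by
  \<open>swap_diff_cong\<close>. The value 0 in the degenerate cases lets the additivity laws below
  hold without distinctness conditions.\<close>

definition swap_diff :: "'a \<Rightarrow> 'a \<Rightarrow> 'a \<Rightarrow> 'a \<Rightarrow> int" where
  "swap_diff i j x y = (if i = j \<or> x = y then 0 else
    let \<sigma> = (SOME \<sigma>. \<sigma> permutes S \<and> \<sigma> i = x \<and> \<sigma> j = y) in f \<sigma> - f (\<sigma> \<circ> transpose i j))"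

lemma swap_diff_eq:
  assumes \<sigma>: "\<sigma> permutes S" and ij: "i \<in> S" "j \<in> S"
  shows "f \<sigma> - f (\<sigma> \<circ> transpose i j) = swap_diff i j (\<sigma> i) (\<sigma> j)"
proof (cases "i = j")
  case False
  then have neq: "\<sigma> i \<noteq> \<sigma> j" using \<sigma> by (metis permutes_inverses(2))
  define \<tau> where "\<tau> = (SOME \<tau>. \<tau> permutes S \<and> \<tau> i = \<sigma> i \<and> \<tau> j = \<sigma> j)"
  have "\<tau> permutes S \<and> \<tau> i = \<sigma> i \<and> \<tau> j = \<sigma> j" unfolding \<tau>_def
    by (rule someI[of _ \<sigma>]) (use \<sigma> in auto)
  then have "f \<sigma> - f (\<sigma> \<circ> transpose i j) = f \<tau> - f (\<tau> \<circ> transpose i j)"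
    using swap_diff_cong[OF \<sigma> _ ij] by metis
  then show ?thesis using False neq by (simp add: swap_diff_def \<tau>_def Let_def)
qed (simp add: swap_diff_def)

lemma swap_diff_degenerate [simp]: "swap_diff i i x y = 0" "swap_diff i j x x = 0"
  by (simp_all add: swap_diff_def)

lemma swap_diff_antisym:
  assumes "i \<in> S" "j \<in> S" "x \<in> S" "y \<in> S"
  shows "swap_diff i j y x = - swap_diff i j x y"
proof (cases "i = j \<or> x = y")
  case False
  then obtain \<sigma> where \<sigma>: "\<sigma> permutes S" "\<sigma> i = x" "\<sigma> j = y"
    using permutes_extending[of "[i, j]" "[x, y]" S] assms by auto
  show ?thesis
    using swap_diff_eq[OF \<sigma>(1) assms(1,2)] swap_diff_eq[OF permutes_swap[OF \<sigma>(1) assms(1,2)] assms(1,2)] \<sigma>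
    by (simp add: comp_assoc)
qed auto

text \<open>The transposition \<open>(i k)\<close> is the product \<open>(i j)(j k)(i j)\<close>;
  the changes of \<open>f\<close> along these three swaps telescope.\<close>

lemma swap_diff_triangle:
  assumes "{i, j, k} \<subseteq> S" "distinct [i, j, k]" "{x, y, z} \<subseteq> S" "distinct [x, y, z]"
  shows "swap_diff i k x z = swap_diff i j x y + swap_diff j k x z + swap_diff i j y z"
proof -
  obtain \<sigma> where \<sigma>: "\<sigma> permutes S" "\<sigma> i = x" "\<sigma> j = y" "\<sigma> k = z"
    using permutes_extending[of "[i, j, k]" "[x, y, z]" S] assms by auto
  have S: "i \<in> S" "j \<in> S" "k \<in> S" and neq: "i \<noteq> j" "k \<noteq> i" "k \<noteq> j"
    using assms by auto
  define \<sigma>1 \<sigma>2 where "\<sigma>1 = \<sigma> \<circ> transpose i j" and "\<sigma>2 = \<sigma>1 \<circ> transpose j k"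
  have 1: "\<sigma>1 permutes S" unfolding \<sigma>1_def by (intro permutes_swap \<sigma> S)
  have 2: "\<sigma>2 permutes S" unfolding \<sigma>2_def by (intro permutes_swap 1 S)
  have "\<sigma>2 \<circ> transpose i j = \<sigma> \<circ> transpose i k"
    using transpose_comp_triple[of i k j] assms(2) by (simp add: \<sigma>2_def \<sigma>1_def comp_assoc)
  moreover have "f \<sigma> - f \<sigma>1 = swap_diff i j x y"
    using swap_diff_eq[OF \<sigma>(1) S(1,2)] \<sigma> by (simp add: \<sigma>1_def)
  moreover have "f \<sigma>1 - f \<sigma>2 = swap_diff j k x z"
    using swap_diff_eq[OF 1 S(2,3)] \<sigma> neq by (simp add: \<sigma>2_def) (simp add: \<sigma>1_def)
  moreover have "f \<sigma>2 - f (\<sigma>2 \<circ> transpose i j) = swap_diff i j y z"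
    using swap_diff_eq[OF 2 S(1,2)] \<sigma> neq by (simp add: \<sigma>2_def \<sigma>1_def)
  moreover have "f \<sigma> - f (\<sigma> \<circ> transpose i k) = swap_diff i k x z"
    using swap_diff_eq[OF \<sigma>(1) S(1,3)] \<sigma> by simp
  ultimately show ?thesis by simp
qed

text \<open>By the triangle identity the cyclic sum over three values is unchanged when one
  value is replaced by a fourth one. Three such replacements exchange two of the values,
  which negates the sum.\<close>
lemma swap_diff_add_values:
  assumes ij: "i \<in> S" "j \<in> S" and xyz: "x \<in> S" "y \<in> S" "z \<in> S"
  shows "swap_diff i j x y + swap_diff i j y z = swap_diff i j x z"
proof (cases "i = j \<or> x = y \<or> y = z \<or> x = z")
  case True
  then show ?thesis using swap_diff_antisym[OF ij xyz(1,2)] by auto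
next
  case False
  define h where "h = swap_diff i j"
  obtain k where k: "k \<in> S" "k \<noteq> i" "k \<noteq> j" using ex_outside[OF fin card_ge] by metis
  obtain w where w: "w \<in> S" "w \<noteq> x" "w \<noteq> y" "w \<noteq> z" using ex_outside[OF fin card_ge] by metis
  have anti: "h q p = - h p q" if "p \<in> S" "q \<in> S" for p q
    unfolding h_def using swap_diff_antisym[OF ij that] .
  \<comment> \<open>In the triangle identity through \<open>k\<close> only the two terms collected
    here involve the middle value.\<close>
  have mid: "h p q + h q r = h p q' + h q' r"
    if "{p, q, q', r} \<subseteq> S" "distinct [p, q, r]" "distinct [p, q', r]" for p q q' r
    unfolding h_def
    using swap_diff_triangle[of i j k p q r] swap_diff_triangle[of i j k p q' r] that ij k False by auto
  \<comment> \<open>In the sum of these three equations all terms with \<open>w\<close> cancel, and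
    twice the claim remains.\<close>
  have "h x y + h y z = h x w + h w z" using mid[of x y w z] xyz w False by auto
  moreover have "h z x + h x w = h z y + h y w" using mid[of z x y w] xyz w False by auto
  moreover have "h y w + h w z = h y x + h x z" using mid[of y w x z] xyz w False by auto
  ultimately show ?thesis
    using anti[of x y] anti[of y z] anti[of x z] xyz unfolding h_def by simp
qed

text \<open>Additivity in the values merges the two terms of the triangle identity that share the
  positions \<open>i\<close> and \<open>j\<close>.\<close>

lemma swap_diff_add_positions:
  assumes ijk: "i \<in> S" "j \<in> S" "k \<in> S" and xz: "x \<in> S" "z \<in> S"
  shows "swap_diff i j x z + swap_diff j k x z = swap_diff i k x z"
proof -
  have sym: "swap_diff q p x z = - swap_diff p q x z" if pq: "p \<in> S" "q \<in> S" for p q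
  proof (cases "p = q \<or> x = z")
    case False
    then obtain \<sigma> where \<sigma>: "\<sigma> permutes S" "\<sigma> q = x" "\<sigma> p = z"
      using permutes_extending[of "[q, p]" "[x, z]" S] pq xz by auto
    then have "swap_diff q p x z = swap_diff p q z x"
      using swap_diff_eq[OF \<sigma>(1) that] swap_diff_eq[OF \<sigma>(1) that(2,1)]
      by (simp add: transpose_commute)
    then show ?thesis using swap_diff_antisym[OF that xz] by simp
  qed auto
  show ?thesis
  proof (cases "i = j \<or> j = k \<or> i = k \<or> x = z")
    case True
    then show ?thesis using sym[OF ijk(1,2)] by auto
  next
    case False
    obtain y where y: "y \<in> S" "y \<noteq> x" "y \<noteq> z" using ex_outside[OF fin card_ge] by metis
    then show ?thesis
      using swap_diff_triangle[of i j k x y z] swap_diff_add_values[OF ijk(1,2) xz(1) y(1) xz(2)]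
        False ijk xz by auto
  qed
qed

text \<open>A function additive in positions and in values is determined by its values against a
  base point; \<open>p\<close> serves as base position and as base value.\<close>

lemma swap_diff_rect:
  "\<exists>a. \<forall>i\<in>S. \<forall>j\<in>S. \<forall>x\<in>S. \<forall>y\<in>S. swap_diff i j x y = rect a i j x y"
proof -
  obtain p where p: "p \<in> S" using ex_outside[OF fin card_ge] by metis
  define a where "a = (\<lambda>i x. swap_diff i p x p)"
  have "swap_diff i j x y = rect a i j x y" if S: "i \<in> S" "j \<in> S" "x \<in> S" "y \<in> S" for i j x y
  proof -
    have "swap_diff i j x y + swap_diff j p x y = swap_diff i p x y"
      using swap_diff_add_positions[OF S(1,2) p S(3,4)] .
    then show ?thesis
      using swap_diff_add_values[OF S(1) p S(3,4) p] swap_diff_add_values[OF S(2) p S(3,4) p]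
      by (simp add: rect_def a_def)
  qed
  then show ?thesis by blast
qed

text \<open>If all nonzero rectangles use row \<open>r\<close>, swaps of other positions preserve
  \<open>f\<close>, and these connect all permutations with the same value at \<open>r\<close>. A
  common column gives the same for swaps of values other than \<open>c\<close>.\<close>

lemma boolean_dictator:
  assumes bool: "\<And>\<sigma>. f \<sigma> = 0 \<or> f \<sigma> = 1"
  shows "(\<exists>r\<in>S. \<forall>\<sigma> \<tau>. \<sigma> permutes S \<longrightarrow> \<tau> permutes S \<longrightarrow> \<sigma> r = \<tau> r \<longrightarrow> f \<sigma> = f \<tau>)
    \<or> (\<exists>c\<in>S. \<forall>\<sigma> \<tau>. \<sigma> permutes S \<longrightarrow> \<tau> permutes S \<longrightarrow> inv \<sigma> c = inv \<tau> c \<longrightarrow> f \<sigma> = f \<tau>)"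
proof -
  obtain a where a: "\<And>i j x y. i \<in> S \<Longrightarrow> j \<in> S \<Longrightarrow> x \<in> S \<Longrightarrow> y \<in> S \<Longrightarrow>
      swap_diff i j x y = rect a i j x y" using swap_diff_rect by blast
  have diff: "f \<sigma> - f (\<sigma> \<circ> transpose i j) = rect a i j (\<sigma> i) (\<sigma> j)"
    if "\<sigma> permutes S" "i \<in> S" "j \<in> S" for \<sigma> i j
    using swap_diff_eq[OF that] a that by (simp add: permutes_in_image)
  have "rects_meet S S a"
    unfolding rects_meet_def
  proof (intro allI impI)
    fix i j k l x y z w
    assume S: "{i, j, k, l} \<subseteq> S" "{x, y, z, w} \<subseteq> S"
      and dist: "distinct [i, j, k, l]" "distinct [x, y, z, w]"
    obtain \<sigma> where \<sigma>: "\<sigma> permutes S" "\<sigma> i = x" "\<sigma> j = y" "\<sigma> k = z" "\<sigma> l = w"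
      using permutes_extending[of "[i, j, k, l]" "[x, y, z, w]" S] S dist by auto
    have "f \<sigma> - f (\<sigma> \<circ> transpose i j) = rect a i j x y"
      and "f \<sigma> - f (\<sigma> \<circ> transpose k l) = rect a k l z w"
      using diff[OF \<sigma>(1), of i j] diff[OF \<sigma>(1), of k l] \<sigma> S by auto
    \<comment> \<open>Were both differences nonzero, \<open>f\<close> would take the same value
      after either single swap, and \<open>exchange\<close> would make its value after both swaps -1
      or 2.\<close>
    then show "rect a i j x y = 0 \<or> rect a k l z w = 0"
      using exchange[OF \<sigma>(1) S(1) dist(1)] bool[of \<sigma>] bool[of "\<sigma> \<circ> transpose i j"]
        bool[of "\<sigma> \<circ> transpose k l"] bool[of "\<sigma> \<circ> transpose i j \<circ> transpose k l"]
      by linarith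
  qed
  then consider "rects_share_row S S a" | "rects_share_col S S a"
    using rects_share[OF fin fin card_ge card_ge] by blast
  then show ?thesis
  proof cases
    case 1
    then obtain r where r: "r \<in> S"
      "\<And>i j x y. i \<in> S - {r} \<Longrightarrow> j \<in> S - {r} \<Longrightarrow> x \<in> S \<Longrightarrow> y \<in> S \<Longrightarrow> rect a i j x y = 0"
      unfolding rects_share_row_def by blast
    have "f \<sigma> = f \<tau>" if \<sigma>: "\<sigma> permutes S" and \<tau>: "\<tau> permutes S" and eq: "\<sigma> r = \<tau> r" for \<sigma> \<tau>
    proof -
      define \<pi> where "\<pi> = inv \<sigma> \<circ> \<tau>"
      have "\<pi> permutes S" unfolding \<pi>_def using \<sigma> \<tau> by (intro permutes_compose permutes_inv)
      moreover have "\<pi> r = r" using eq[symmetric] permutes_inverses(2)[OF \<sigma>] by (auto simp: \<pi>_def)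
      ultimately have "\<pi> permutes S - {r}" by (auto intro: permutes_superset)
      moreover have "finite (S - {r})" using fin by simp
      ultimately have "\<forall>\<rho>. \<rho> permutes S \<longrightarrow> f (\<rho> \<circ> \<pi>) = f \<rho>"
      proof (induction rule: permutes_induct)
        case (swap b c p)
        have "f (\<rho> \<circ> (transpose b c \<circ> p)) = f \<rho>" if \<rho>: "\<rho> permutes S" for \<rho>
        proof -
          have "\<rho> \<circ> transpose b c permutes S" using \<rho> swap.hyps by (intro permutes_swap) auto
          then have "f (\<rho> \<circ> transpose b c \<circ> p) = f (\<rho> \<circ> transpose b c)"
            using swap.IH by blast
          also have "\<dots> = f \<rho>"
            using diff[OF \<rho>, of b c] r(2)[of b c "\<rho> b" "\<rho> c"] swap.hyps \<rho>
            by (simp add: permutes_in_image)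
          finally show ?thesis by (simp add: comp_assoc)
        qed
        then show ?case by blast
      qed simp
      moreover have "\<tau> = \<sigma> \<circ> \<pi>" unfolding \<pi>_def by (auto simp: fun_eq_iff permutes_inverses[OF \<sigma>])
      ultimately show ?thesis using \<sigma> by simp
    qed
    then show ?thesis using r(1) by blast
  next
    case 2
    then obtain c where c: "c \<in> S"
      "\<And>i j x y. i \<in> S \<Longrightarrow> j \<in> S \<Longrightarrow> x \<in> S - {c} \<Longrightarrow> y \<in> S - {c} \<Longrightarrow> rect a i j x y = 0"
      unfolding rects_share_col_def by blast
    have "f \<sigma> = f \<tau>" if \<sigma>: "\<sigma> permutes S" and \<tau>: "\<tau> permutes S" and eq: "inv \<sigma> c = inv \<tau> c" for \<sigma> \<tau>
    proof -
      \<comment> \<open>Composed on the left, \<open>\<pi>\<close> acts on values and fixes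
        \<open>c\<close>.\<close>
      define \<pi> where "\<pi> = \<tau> \<circ> inv \<sigma>"
      have "\<pi> permutes S" unfolding \<pi>_def using \<sigma> \<tau> by (intro permutes_compose permutes_inv)
      moreover have "\<pi> c = c" using eq permutes_inverses(1)[OF \<tau>] by (auto simp: \<pi>_def)
      ultimately have "\<pi> permutes S - {c}" by (auto intro: permutes_superset)
      moreover have "finite (S - {c})" using fin by simp
      ultimately have "f (\<pi> \<circ> \<sigma>) = f \<sigma>"
      proof (induction rule: permutes_induct)
        case (swap x y p)
        have "p permutes S" using swap.hyps by (auto intro: permutes_subset)
        then have \<rho>: "p \<circ> \<sigma> permutes S" using \<sigma> by (intro permutes_compose)
        let ?i = "inv (p \<circ> \<sigma>) x" and ?j = "inv (p \<circ> \<sigma>) y"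
        \<comment> \<open>A swap of two values is a swap of the positions where they occur, which
          brings it into the form of \<open>diff\<close>.\<close>
        have "transpose x y \<circ> p \<circ> \<sigma> = p \<circ> \<sigma> \<circ> transpose ?i ?j"
          using transpose_comp_eq[OF permutes_bij[OF \<rho>]] by (simp add: comp_assoc)
        moreover have ij: "?i \<in> S" "?j \<in> S"
          using swap.hyps permutes_in_image[OF permutes_inv[OF \<rho>]] by auto
        moreover have "(p \<circ> \<sigma>) ?i = x" "(p \<circ> \<sigma>) ?j = y" using permutes_inverses(1)[OF \<rho>] by auto
        ultimately have "f (transpose x y \<circ> p \<circ> \<sigma>) = f (p \<circ> \<sigma>)"
          using diff[OF \<rho> ij] c(2)[OF ij, of x y] swap.hyps by simp
        then show ?case using swap.IH by metis
      qed simp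
      moreover have "\<pi> \<circ> \<sigma> = \<tau>" unfolding \<pi>_def by (auto simp: fun_eq_iff permutes_inverses[OF \<sigma>])
      ultimately show ?thesis by simp
    qed
    then show ?thesis using c(1) by blast
  qed
qed

end

section \<open>Families of permutations without large matchings\<close>

lemma finite_Sym: "finite (Sym n)"
  by (simp add: Sym_def finite_permutations)

lemma card_le_nu:
  assumes "F \<subseteq> Sym n" "G \<subseteq> F" "\<forall>\<sigma>\<in>G. \<forall>\<tau>\<in>G. \<sigma> \<noteq> \<tau> \<longrightarrow> \<not> intersect n \<sigma> \<tau>"
  shows "card G \<le> nu n F"
  unfolding nu_def
proof (rule Max_ge)
  have "finite F" using assms(1) finite_Sym finite_subset by blast
  then have "finite (card ` Pow F)" by simp
  then show "finite {card G | G. G \<subseteq> F \<and> (\<forall>\<sigma>\<in>G. \<forall>\<tau>\<in>G. \<sigma> \<noteq> \<tau> \<longrightarrow> \<not> intersect n \<sigma> \<tau>)}"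
    by (rule rev_finite_subset) auto
qed (use assms in blast)

text \<open>Composing with an injective \<open>g\<close> on the left keeps permutations disjoint, so
  the members of \<open>F\<close> in a translate form a matching.\<close>

lemma latin_translate_card_le_nu:
  assumes F: "F \<subseteq> Sym n" and L: "latin {1..n} L" and g: "g \<in> Sym n"
  shows "card {p \<in> L. g \<circ> p \<in> F} \<le> nu n F"
proof -
  let ?K = "{p \<in> L. g \<circ> p \<in> F}"
  have inj: "g x = g y \<longleftrightarrow> x = y" for x y
    using g unfolding Sym_def by (metis mem_Collect_eq permutes_inverses(2))
  have "inj_on ((\<circ>) g) ?K" by (auto simp: inj_on_def fun_eq_iff inj)
  then have "card ?K = card ((\<circ>) g ` ?K)" by (simp add: card_image)
  also have "\<dots> \<le> nu n F"
  proof (rule card_le_nu[OF F])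
    show "\<forall>\<sigma>\<in>(\<circ>) g ` ?K. \<forall>\<tau>\<in>(\<circ>) g ` ?K. \<sigma> \<noteq> \<tau> \<longrightarrow> \<not> intersect n \<sigma> \<tau>"
    proof (intro ballI impI)
      fix \<sigma> \<tau> assume "\<sigma> \<in> (\<circ>) g ` ?K" "\<tau> \<in> (\<circ>) g ` ?K" and neq: "\<sigma> \<noteq> \<tau>"
      then obtain p q where pq: "p \<in> L" "q \<in> L" "\<sigma> = g \<circ> p" "\<tau> = g \<circ> q" by blast
      then have "p \<noteq> q" using neq by blast
      then have "\<forall>x\<in>{1..n}. p x \<noteq> q x"
        using L pq unfolding latin_def pointwise_disjoint_def by blast
      then show "\<not> intersect n \<sigma> \<tau>" unfolding intersect_def pq by (simp add: inj)
    qed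
  qed auto
  finally show ?thesis .
qed

text \<open>Double counting: for each of the \<open>n\<close> permutations \<open>p\<close> in
  \<open>L\<close>, every member of \<open>F\<close> is \<open>g \<circ> p\<close> for exactly one
  \<open>g\<close>.\<close>

lemma sum_latin_translates:
  assumes F: "F \<subseteq> Sym n" and L: "latin {1..n} L"
  shows "(\<Sum>g\<in>Sym n. card {p \<in> L. g \<circ> p \<in> F}) = n * card F"
proof -
  have fL: "finite L" "card L = n" using L by (auto simp: latin_def)
  have shift: "card {g \<in> Sym n. g \<circ> p \<in> F} = card F" if "p \<in> L" for p
  proof -
    have p: "p permutes {1..n}" using L that by (simp add: latin_def)
    have 1: "g \<circ> p \<circ> inv p = g" "g \<circ> inv p \<circ> p = g" for g :: "nat \<Rightarrow> nat"
      by (simp_all add: comp_assoc permutes_inv_o[OF p])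
    have "bij_betw (\<lambda>g. g \<circ> p) {g \<in> Sym n. g \<circ> p \<in> F} F"
    proof (rule bij_betw_byWitness[where f' = "\<lambda>h. h \<circ> inv p"])
      show "(\<lambda>h. h \<circ> inv p) ` F \<subseteq> {g \<in> Sym n. g \<circ> p \<in> F}"
        using F permutes_compose[OF permutes_inv[OF p]] by (auto simp: 1 Sym_def)
    qed (auto simp: 1)
    then show ?thesis by (rule bij_betw_same_card)
  qed
  have "(\<Sum>g\<in>Sym n. card {p \<in> L. g \<circ> p \<in> F}) = (\<Sum>p\<in>L. card {g \<in> Sym n. g \<circ> p \<in> F})"
    by (rule sum_multicount_gen) (use fL finite_Sym in auto)
  also have "\<dots> = n * card F" using shift fL by simp
  finally show ?thesis .
qed

section \<open>The bound and the case of equality\<close>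

lemma card_Sym: "card (Sym n) = fact n"
  by (simp add: Sym_def card_permutations)

lemma card_le_of_nu_less:
  assumes "n \<ge> 1" and F: "F \<subseteq> Sym n" and nu: "nu n F < s"
  shows "card F \<le> (s - 1) * fact (n - 1)"
proof -
  obtain L where L: "latin {1..n} L" using latin_exists[of "{1..n}"] assms(1) by auto
  have "n * card F = (\<Sum>g\<in>Sym n. card {p \<in> L. g \<circ> p \<in> F})"
    using sum_latin_translates[OF F L] by simp
  also have "\<dots> \<le> (\<Sum>g\<in>Sym n. s - 1)"
    using latin_translate_card_le_nu[OF F L] nu by (intro sum_mono) fastforce
  also have "\<dots> = n * ((s - 1) * fact (n - 1))"
    using assms(1) fact_reduce[of n, where 'a = nat] by (simp add: card_Sym)
  finally show ?thesis using assms(1) by simp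
qed

text \<open>Equality in the average forces equality for every translate, in particular for the
  translate by \<open>id\<close>.\<close>

lemma latin_inter_card_of_extremal:
  assumes "n \<ge> 1" and F: "F \<subseteq> Sym n" and nu: "nu n F < s"
    and card: "card F = (s - 1) * fact (n - 1)" and L: "latin {1..n} L"
  shows "card {p \<in> L. p \<in> F} = s - 1"
proof -
  have "(\<Sum>g\<in>Sym n. card {p \<in> L. g \<circ> p \<in> F}) = (\<Sum>g\<in>Sym n. s - 1)"
    using assms(1) fact_reduce[of n, where 'a = nat]
    by (simp add: sum_latin_translates[OF F L] card card_Sym)
  moreover have "card {p \<in> L. g \<circ> p \<in> F} \<le> s - 1" if "g \<in> Sym n" for g
    using latin_translate_card_le_nu[OF F L that] nu by simp
  moreover have "id \<in> Sym n" by (simp add: Sym_def)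
  ultimately have "card {p \<in> L. id \<circ> p \<in> F} = s - 1"
    using sum_mono_inv[of "\<lambda>g. card {p \<in> L. g \<circ> p \<in> F}" "Sym n" "\<lambda>_. s - 1" id] finite_Sym by blast
  then show ?thesis by simp
qed

text \<open>By cardinality \<open>e\<close> is a bijection from \<open>L\<close> onto
  \<open>S\<close>. Evaluation at a point and the preimage of a point are the two instances
  used.\<close>

lemma latin_fiber_card:
  assumes L: "latin S L" and fin: "finite S" and e: "inj_on e L" "e ` L \<subseteq> S" and Y: "Y \<subseteq> S"
  shows "card {p \<in> L. e p \<in> Y} = card Y"
proof -
  have "card (e ` L) = card S" using card_image[OF e(1)] L by (simp add: latin_def)
  then have "e ` L = S" using card_subset_eq[OF fin e(2)] by simp
  then have "e ` {p \<in> L. e p \<in> Y} = Y" using Y by auto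
  moreover have "inj_on e {p \<in> L. e p \<in> Y}" by (rule inj_on_subset[OF e(1)]) auto
  ultimately show ?thesis using card_image by metis
qed

text \<open>\<open>boolean_dictator\<close> makes \<open>F\<close> a union of stars through one
  position or one value. A single Latin square counts them: it meets each star once and contains
  \<open>s - 1\<close> members of \<open>F\<close>. The bound 8 is that of
  \<open>transposition_exchange\<close>.\<close>

lemma extremal_family:
  assumes n: "n \<ge> 8" and F: "F \<subseteq> Sym n" and nu: "nu n F < s"
    and card: "card F = (s - 1) * fact (n - 1)"
  shows "(\<exists>x\<in>{1..n}. \<exists>Y. Y \<subseteq> {1..n} \<and> card Y = s - 1 \<and> F = (\<Union>y\<in>Y. Star n x y))
       \<or> (\<exists>y\<in>{1..n}. \<exists>X. X \<subseteq> {1..n} \<and> card X = s - 1 \<and> F = (\<Union>x\<in>X. Star n x y))"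
proof -
  let ?S = "{1..n}"
  define f :: "(nat \<Rightarrow> nat) \<Rightarrow> int" where "f = (\<lambda>\<sigma>. of_bool (\<sigma> \<in> F))"
  have f01: "f \<sigma> = 0 \<or> f \<sigma> = 1" for \<sigma> by (simp add: f_def)
  have slice: "card {p \<in> L. p \<in> F} = s - 1" if "latin ?S L" for L
    using latin_inter_card_of_extremal[OF _ F nu card that] n by simp
  have const: "sum f L = int (s - 1)" if "latin ?S L" for L
  proof -
    have "finite L" using that by (simp add: latin_def)
    then have "sum f L = int (card {p \<in> L. p \<in> F})" by (simp add: f_def Int_def)
    then show ?thesis using slice[OF that] by simp
  qed
  interpret transposition_additive ?S f
  proof
    fix \<sigma> i j k l assume "\<sigma> permutes ?S" "{i, j, k, l} \<subseteq> ?S" "distinct [i, j, k, l]"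
    then show "f \<sigma> + f (\<sigma> \<circ> transpose i j \<circ> transpose k l)
      = f (\<sigma> \<circ> transpose i j) + f (\<sigma> \<circ> transpose k l)"
      using n by (intro transposition_exchange[OF const]) auto
  qed (use n in auto)
  obtain L where L: "latin ?S L" using latin_exists[of ?S] n by auto
  have perm: "p permutes ?S" if "p \<in> L" for p using L that by (simp add: latin_def)
  have disj: "p = q" if "p \<in> L" "q \<in> L" "x \<in> ?S" "p x = q x" for p q x
    using L that unfolding latin_def pointwise_disjoint_def by blast
  from boolean_dictator[OF f01] consider
    (row) r where "r \<in> ?S" "\<And>\<sigma> \<tau>. \<sigma> permutes ?S \<Longrightarrow> \<tau> permutes ?S \<Longrightarrow> \<sigma> r = \<tau> r \<Longrightarrow> f \<sigma> = f \<tau>"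
    | (col) c where "c \<in> ?S"
      "\<And>\<sigma> \<tau>. \<sigma> permutes ?S \<Longrightarrow> \<tau> permutes ?S \<Longrightarrow> inv \<sigma> c = inv \<tau> c \<Longrightarrow> f \<sigma> = f \<tau>"
    by blast
  then show ?thesis
  proof cases
    case row
    define Y where "Y = (\<lambda>\<sigma>. \<sigma> r) ` F"
    have mem: "\<sigma> \<in> F \<longleftrightarrow> \<sigma> r \<in> Y" if \<sigma>: "\<sigma> permutes ?S" for \<sigma>
    proof
      assume "\<sigma> r \<in> Y"
      then obtain \<tau> where \<tau>: "\<tau> \<in> F" "\<sigma> r = \<tau> r" by (auto simp: Y_def)
      then have "f \<sigma> = f \<tau>" using F \<sigma> by (intro row(2)) (auto simp: Sym_def)
      then show "\<sigma> \<in> F" using \<tau>(1) by (simp add: f_def split: if_splits)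
    qed (auto simp: Y_def)
    have Y: "Y \<subseteq> ?S" using F row(1) permutes_in_image unfolding Y_def Sym_def by fastforce
    have "inj_on (\<lambda>p. p r) L" using disj row(1) by (auto intro: inj_onI)
    moreover have "(\<lambda>p. p r) ` L \<subseteq> ?S" using perm row(1) permutes_in_image by fastforce
    ultimately have "card {p \<in> L. p r \<in> Y} = card Y" using latin_fiber_card[OF L _ _ _ Y] by blast
    moreover have "{p \<in> L. p r \<in> Y} = {p \<in> L. p \<in> F}" using mem perm by blast
    ultimately have "card Y = s - 1" using slice[OF L] by simp
    moreover have "F = (\<Union>y\<in>Y. Star n r y)"
      using mem F by (auto simp: Star_def Sym_def)
    ultimately show ?thesis using Y row(1) by blast
  next
    case col
    define X where "X = (\<lambda>\<sigma>. inv \<sigma> c) ` F"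
    have mem: "\<sigma> \<in> F \<longleftrightarrow> inv \<sigma> c \<in> X" if \<sigma>: "\<sigma> permutes ?S" for \<sigma>
    proof
      assume "inv \<sigma> c \<in> X"
      then obtain \<tau> where \<tau>: "\<tau> \<in> F" "inv \<sigma> c = inv \<tau> c" by (auto simp: X_def)
      then have "f \<sigma> = f \<tau>" using F \<sigma> by (intro col(2)) (auto simp: Sym_def)
      then show "\<sigma> \<in> F" using \<tau>(1) by (simp add: f_def split: if_splits)
    qed (auto simp: X_def)
    have inS: "inv p c \<in> ?S" if "p permutes ?S" for p
      using permutes_in_image[OF permutes_inv[OF that]] col(1) by simp
    have X: "X \<subseteq> ?S" using F inS unfolding X_def Sym_def by blast
    have "inj_on (\<lambda>p. inv p c) L"
    proof (rule inj_onI)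
      fix p q assume pq: "p \<in> L" "q \<in> L" "inv p c = inv q c"
      then have "p (inv p c) = q (inv p c)"
        using permutes_inverses(1)[OF perm[OF pq(1)]] permutes_inverses(1)[OF perm[OF pq(2)]] by metis
      then show "p = q" using disj[OF pq(1,2) inS[OF perm[OF pq(1)]]] by blast
    qed
    moreover have "(\<lambda>p. inv p c) ` L \<subseteq> ?S" using perm inS by blast
    ultimately have "card {p \<in> L. inv p c \<in> X} = card X" using latin_fiber_card[OF L _ _ _ X] by blast
    moreover have "{p \<in> L. inv p c \<in> X} = {p \<in> L. p \<in> F}" using mem perm by blast
    ultimately have "card X = s - 1" using slice[OF L] by simp
    moreover have "F = (\<Union>x\<in>X. Star n x c)"
    proof -
      have "\<sigma> \<in> F \<longleftrightarrow> \<sigma> \<in> (\<Union>x\<in>X. Star n x c)" for \<sigma>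
      proof (cases "\<sigma> permutes ?S")
        case True
        have "\<sigma> x = c \<longleftrightarrow> inv \<sigma> c = x" for x using permutes_inv_eq[OF True] by blast
        then show ?thesis using mem[OF True] True by (auto simp: Star_def Sym_def)
      next
        case False
        then show ?thesis using F by (auto simp: Star_def Sym_def)
      qed
      then show ?thesis by blast
    qed
    ultimately show ?thesis using X col(1) by blast
  qed
qed

theorem theorem4:
  fixes n s :: nat and F :: "(nat \<Rightarrow> nat) set"
  assumes "s \<ge> 2"
    and "real s \<le> real n / (2 ^ 17 * ln (real n))"
    and "F \<subseteq> Sym n"
    and "nu n F < s"
  shows "card F \<le> (s - 1) * fact (n - 1) \<and>
         (card F = (s - 1) * fact (n - 1) \<longrightarrow>
          ((\<exists>x\<in>{1..n}. \<exists>Y. Y \<subseteq> {1..n} \<and> card Y = s - 1 \<and> F = (\<Union>y\<in>Y. Star n x y))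
         \<or> (\<exists>y\<in>{1..n}. \<exists>X. X \<subseteq> {1..n} \<and> card X = s - 1 \<and> F = (\<Union>x\<in>X. Star n x y))))"
proof -
  \<comment> \<open>For \<open>n = 0\<close> and \<open>n = 1\<close> the quotient is 0, in the
    latter case as a division by \<open>ln 1 = 0\<close>, which contradicts
    \<open>s \<ge> 2\<close>.\<close>
  have "n \<noteq> 0" using assms(1,2) by (cases n) auto
  moreover have "n \<noteq> 1" using assms(1,2) by auto
  ultimately have n2: "real n \<ge> 2" by linarith
  \<comment> \<open>This gives \<open>ln n \<ge> 1 - 1 / n \<ge> 1 / 2\<close>, so the denominator
    is positive and bounded away from 0.\<close>
  have "ln (1 / real n) \<le> 1 / real n - 1" using n2 by (intro ln_le_minus_one) simp
  moreover have "1 / real n \<le> 1 / 2" using n2 by simp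
  moreover have "ln (1 / real n) = - ln (real n)" using n2 by (simp add: ln_div)
  ultimately have ln: "ln (real n) \<ge> 1 / 2" by linarith
  have "2 \<le> real n / (2 ^ 17 * ln (real n))" using assms(1,2) by linarith
  then have "2 * (2 ^ 17 * ln (real n)) \<le> real n"
    using ln by (subst (asm) pos_le_divide_eq) auto
  then have "n \<ge> 8" using ln by simp
  then show ?thesis
    using card_le_of_nu_less[OF _ assms(3,4)] extremal_family[OF _ assms(3,4)] by simp
qed

end
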